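(* Let $C=(\varphi,\Phi)$ be a $*$-strongly measurable skew-evolution semiflow on $Y=X\times V$. Then the following statements are equivalent: (i) $C$ is uniformly exponentially stable; (ii) $C$ is uniformly stable and there exist a function $R\in\mathcal{R}$ and a constant $\overline{N}\geq 1$ such that $$\int_{t_{0}}^{t}R\left(\Vert\Phi(t,s,\varphi(s,t_{0},x))^{*}v^{*}\Vert\right)ds\leq\overline{N}$$ for all $(t,t_{0},x,v^{*})\in T\times X\times V^{*}$ with $\Vert v^{*}\Vert\leq 1$; (iii) $C$ has uniform exponential growth and there exist a function $R\in\mathcal{R}$ and a constant $\overline{N}\geq 1$ such that $$\int_{t_{0}}^{t}R\left(\Vert\Phi(t,s,\varphi(s,t_{0},x))^{*}v^{*}\Vert\right)ds\leq\overline{N}$$ for all $(t,t_{0},x,v^{*})\in T\times X\times V^{*}$ with $\Vert v^{*}\Vert\leq 1$.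
   Context: $(X,d)$ is a metric space, $V$ a Banach space, $V^{*}$ its topological dual, $\mathcal{B}(V)$ the space of bounded linear operators on $V$, $I$ the identity on $V$, $Y=X\times V$, $\mathbb{R}_{+}=[0,\infty)$, $T=\{(t,t_{0})\in\mathbb{R}_{+}^{2}: t\geq t_{0}\}$. Norms on $V$, $V^{*}$ and $\mathcal{B}(V)$ are denoted $\Vert\cdot\Vert$; $A^{*}$ denotes the adjoint on $V^{*}$ of $A\in\mathcal{B}(V)$. $\mathcal{R}$ is the set of nondecreasing functions $R:\mathbb{R}_{+}\to\mathbb{R}_{+}$ with $R(0)=0$ and $R(t)>0$ for all $t>0$. An evolution semiflow on $X$ is a mapping $\varphi:T\times X\to X$ with $\varphi(t,t,x)=x$ for all $(t,x)\in\mathbb{R}_{+}\times X$ and $\varphi(t,s,\varphi(s,t_{0},x))=\varphi(t,t_{0},x)$ for all $(t,s),(s,t_{0})\in T$, $x\in X$. An evolution cocycle over $\varphi$ is a mapping $\Phi:T\times X\to\mathcal{B}(V)$ with $\Phi(t,t,x)=I$ for all $t\geq 0$, $x\in X$ and $\Phi(t,s,\varphi(s,t_{0},x))\Phi(s,t_{0},x)=\Phi(t,t_{0},x)$ for all $(t,s),(s,t_{0})\in T$, $x\in X$. The mapping $C:T\times Y\to Y$, $C(t,s,x,v)=(\varphi(t,s,x),\Phi(t,s,x)v)$, is then called a skew-evolution semiflow on $Y$, written $C=(\varphi,\Phi)$. $C$ is $*$-strongly measurable if for all $(t,t_{0},x,v^{*})\in T\times X\times V^{*}$ the mapping $s\mapsto\Vert\Phi(t,s,\varphi(s,t_{0},x))^{*}v^{*}\Vert$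 is measurable on $[t_{0},t]$. $C$ has uniform exponential growth if there exist constants $M\geq 1$, $\omega>0$ with $\Vert\Phi(t,t_{0},x)v\Vert\leq Me^{\omega(t-s)}\Vert\Phi(s,t_{0},x)v\Vert$ for all $(t,s),(s,t_{0})\in T$ and all $(x,v)\in Y$. $C$ is uniformly stable if there exists a constant $N\geq 1$ with $\Vert\Phi(t,t_{0},x)v\Vert\leq N\Vert\Phi(s,t_{0},x)v\Vert$ for all such $t,s,t_{0},x,v$. $C$ is uniformly exponentially stable if there exist constants $N\geq 1$, $\nu>0$ with $\Vert\Phi(t,t_{0},x)v\Vert\leq Ne^{-\nu(t-s)}\Vert\Phi(s,t_{0},x)v\Vert$ for all such $t,s,t_{0},x,v$. *)

theory Defs
  imports "HOL-Analysis.Analysis"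
begin

definition time_pairs :: "(real \<times> real) set" where
  "time_pairs = {(t, t0). 0 \<le> t0 \<and> t0 \<le> t}"

definition evolution_semiflow ::
  "(real \<Rightarrow> real \<Rightarrow> 'x::metric_space \<Rightarrow> 'x) \<Rightarrow> bool" where
  "evolution_semiflow \<phi> \<longleftrightarrow>
     (\<forall>t\<ge>0. \<forall>x. \<phi> t t x = x) \<and>
     (\<forall>t s t0 x. (t, s) \<in> time_pairs \<longrightarrow> (s, t0) \<in> time_pairs \<longrightarrow>
        \<phi> t s (\<phi> s t0 x) = \<phi> t t0 x)"

definition evolution_cocycle ::
  "(real \<Rightarrow> real \<Rightarrow> 'x::metric_space \<Rightarrow> 'x) \<Rightarrow>
   (real \<Rightarrow> real \<Rightarrow> 'x \<Rightarrow> ('v::banach \<Rightarrow>\<^sub>L 'v)) \<Rightarrow> bool" where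
  "evolution_cocycle \<phi> \<Phi> \<longleftrightarrow>
     (\<forall>t\<ge>0. \<forall>x. \<Phi> t t x = id_blinfun) \<and>
     (\<forall>t s t0 x. (t, s) \<in> time_pairs \<longrightarrow> (s, t0) \<in> time_pairs \<longrightarrow>
        \<Phi> t s (\<phi> s t0 x) o\<^sub>L \<Phi> s t0 x = \<Phi> t t0 x)"

text \<open>
  A skew-evolution semiflow is determined by the pair of its semiflow and its cocycle.
  Both are total functions; their values at times outside \<^const>\<open>time_pairs\<close>
  are arbitrary and never used.
\<close>

definition skew_evolution_semiflow ::
  "(real \<Rightarrow> real \<Rightarrow> 'x::metric_space \<Rightarrow> 'x) \<Rightarrow>
   (real \<Rightarrow> real \<Rightarrow> 'x \<Rightarrow> ('v::banach \<Rightarrow>\<^sub>L 'v)) \<Rightarrow> bool" where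
  "skew_evolution_semiflow \<phi> \<Phi> \<longleftrightarrow> evolution_semiflow \<phi> \<and> evolution_cocycle \<phi> \<Phi>"

definition dual_adjoint ::
  "('v::real_normed_vector \<Rightarrow>\<^sub>L 'v) \<Rightarrow> ('v \<Rightarrow>\<^sub>L real) \<Rightarrow> ('v \<Rightarrow>\<^sub>L real)" where
  "dual_adjoint A f = f o\<^sub>L A"

definition star_strongly_measurable ::
  "(real \<Rightarrow> real \<Rightarrow> 'x::metric_space \<Rightarrow> 'x) \<Rightarrow>
   (real \<Rightarrow> real \<Rightarrow> 'x \<Rightarrow> ('v::banach \<Rightarrow>\<^sub>L 'v)) \<Rightarrow> bool" where
  "star_strongly_measurable \<phi> \<Phi> \<longleftrightarrow>
     (\<forall>t t0 x f. (t, t0) \<in> time_pairs \<longrightarrow>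
        (\<lambda>s. norm (dual_adjoint (\<Phi> t s (\<phi> s t0 x)) f))
          \<in> borel_measurable (lebesgue_on {t0..t}))"

definition uniform_exponential_growth ::
  "(real \<Rightarrow> real \<Rightarrow> 'x::metric_space \<Rightarrow> ('v::banach \<Rightarrow>\<^sub>L 'v)) \<Rightarrow> bool" where
  "uniform_exponential_growth \<Phi> \<longleftrightarrow>
     (\<exists>M\<ge>1. \<exists>\<omega>>0. \<forall>t s t0 x v. (t, s) \<in> time_pairs \<longrightarrow> (s, t0) \<in> time_pairs \<longrightarrow>
        norm (\<Phi> t t0 x v) \<le> M * exp (\<omega> * (t - s)) * norm (\<Phi> s t0 x v))"

definition uniformly_stable ::
  "(real \<Rightarrow> real \<Rightarrow> 'x::metric_space \<Rightarrow> ('v::banach \<Rightarrow>\<^sub>L 'v)) \<Rightarrow> bool" where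
  "uniformly_stable \<Phi> \<longleftrightarrow>
     (\<exists>N\<ge>1. \<forall>t s t0 x v. (t, s) \<in> time_pairs \<longrightarrow> (s, t0) \<in> time_pairs \<longrightarrow>
        norm (\<Phi> t t0 x v) \<le> N * norm (\<Phi> s t0 x v))"

definition uniformly_exponentially_stable ::
  "(real \<Rightarrow> real \<Rightarrow> 'x::metric_space \<Rightarrow> ('v::banach \<Rightarrow>\<^sub>L 'v)) \<Rightarrow> bool" where
  "uniformly_exponentially_stable \<Phi> \<longleftrightarrow>
     (\<exists>N\<ge>1. \<exists>\<nu>>0. \<forall>t s t0 x v. (t, s) \<in> time_pairs \<longrightarrow> (s, t0) \<in> time_pairs \<longrightarrow>
        norm (\<Phi> t t0 x v) \<le> N * exp (- \<nu> * (t - s)) * norm (\<Phi> s t0 x v))"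

text \<open>
  Only the values on the nonnegative reals matter; nonnegativity there follows
  from the three conditions.
\<close>

definition rate_functions :: "(real \<Rightarrow> real) set" where
  "rate_functions = {R. mono_on {0..} R \<and> R 0 = 0 \<and> (\<forall>t>0. R t > 0)}"

text \<open>
  The integrand is nonnegative, so the integral is taken in the extended
  nonnegative reals; the bound therefore includes its finiteness.
\<close>

definition adjoint_integral_bound ::
  "(real \<Rightarrow> real \<Rightarrow> 'x::metric_space \<Rightarrow> 'x) \<Rightarrow>
   (real \<Rightarrow> real \<Rightarrow> 'x \<Rightarrow> ('v::banach \<Rightarrow>\<^sub>L 'v)) \<Rightarrow> (real \<Rightarrow> real) \<Rightarrow> real \<Rightarrow> bool" where
  "adjoint_integral_bound \<phi> \<Phi> R N \<longleftrightarrow>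
     (\<forall>t t0 x f. (t, t0) \<in> time_pairs \<longrightarrow> norm f \<le> 1 \<longrightarrow>
        (\<integral>\<^sup>+ s\<in>{t0..t}. ennreal (R (norm (dual_adjoint (\<Phi> t s (\<phi> s t0 x)) f))) \<partial>lebesgue)
          \<le> ennreal N)"

end

theory Submission
  imports Defs
begin

text \<open>
  The substantial direction derives exponential stability from exponential growth and the
  integral bound. Fix \<open>t\<close> and \<open>x\<close> and a functional \<open>f\<close> in the dual unit ball, and let
  \<open>g s\<close> be the norm of the adjoint of \<open>\<Phi> t s (\<phi> s t0 x)\<close> applied to \<open>f\<close>. The cocycle
  identity factors \<open>\<Phi> t t0 x\<close> through time \<open>s\<close>, so \<open>g t0 \<le> g s * norm (\<Phi> s t0 x)\<close>. Hence if
  the cocycle is bounded by \<open>B\<close> on a window of length \<open>\<tau>\<close> after \<open>t0\<close>, then \<open>g t0 > B * \<epsilon>\<close> would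
  keep \<open>g\<close> above \<open>\<epsilon>\<close> on the whole window, and the integral would be at least \<open>\<tau> * R \<epsilon>\<close>. A
  window with \<open>\<tau> * R \<epsilon> > N\<close> therefore forces \<open>g t0 \<le> B * \<epsilon>\<close> for all \<open>f\<close>, that is,
  \<open>norm (\<Phi> t t0 x) \<le> B * \<epsilon>\<close> at all times after the window. This is
  \<open>late_norm_bound\<close>. The rate function \<open>R\<close> may be bounded, so a large value of \<open>g\<close> is not
  by itself contradictory; it is the length of the window that is exploited.
  
  The estimate is used twice. With \<open>\<epsilon> = 1\<close> and the exponential growth bound on the window it
  gives a uniform bound \<open>K\<close> on the whole cocycle. With \<open>\<epsilon> = 1 / (2 * K)\<close> and the bound \<open>K\<close>
  it gives \<open>norm (\<Phi> t t0 x) \<le> 1 / 2\<close> after a fixed delay, and iterating this contraction yields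
  exponential decay (\<open>eventual_contraction_imp_exponentially_stable\<close>). Conversely,
  exponential stability bounds the integral for \<open>R r = r\<close> by that of a decaying exponential,
  and the implications between stability and growth are immediate.
  
  The passage from adjoints back to operators requires that an operator norm be controlled by the
  adjoint on the dual unit ball. This is where the Hahn--Banach theorem enters, in the form that
  every vector is normed by a functional of norm at most one (\<open>norming_functional\<close>). It is
  derived from the fact that a minimal sublinear functional is linear.
\<close>

section \<open>Norming functionals\<close>

text \<open>
  Homogeneity is required only as an inequality for positive scalars: applying it to the inverse
  scalar yields equality, as \<open>sublinear_scaleR\<close> shows.
\<close>

definition sublinear :: "('v::real_vector \<Rightarrow> real) \<Rightarrow> bool" where
  "sublinear p \<longleftrightarrow> (\<forall>x y. p (x + y) \<le> p x + p y) \<and> (\<forall>c>0. \<forall>x. p (c *\<^sub>R x) \<le> c * p x)"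

lemma sublinear_add: "sublinear p \<Longrightarrow> p (x + y) \<le> p x + p y"
  by (simp add: sublinear_def)

lemma sublinear_zero:
  assumes "sublinear p"
  shows "p 0 = 0"
proof -
  have "p (2 *\<^sub>R 0) \<le> 2 * p 0" "p ((1/2) *\<^sub>R 0) \<le> (1/2) * p 0"
    using assms unfolding sublinear_def by (blast intro: zero_less_numeral half_gt_zero zero_less_one)+
  then show ?thesis by simp
qed

lemma sublinear_scaleR:
  assumes "sublinear p" "0 \<le> c"
  shows "p (c *\<^sub>R x) = c * p x"
proof (cases "c = 0")
  case True
  then show ?thesis using sublinear_zero[OF assms(1)] by simp
next
  case False
  then have c: "c > 0" using assms by simp
  have "p (inverse c *\<^sub>R (c *\<^sub>R x)) \<le> inverse c * p (c *\<^sub>R x)"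
    using assms(1) c unfolding sublinear_def by (metis positive_imp_inverse_positive)
  then have "c * p x \<le> p (c *\<^sub>R x)"
    using c by (simp add: field_simps)
  moreover have "p (c *\<^sub>R x) \<le> c * p x"
    using assms(1) c unfolding sublinear_def by blast
  ultimately show ?thesis by simp
qed

lemma sublinear_minus_le:
  assumes "sublinear p"
  shows "- p (- x) \<le> p x"
  using sublinear_add[OF assms, of x "- x"] sublinear_zero[OF assms] by simp

text \<open>
  The infimum of arbitrary sublinear functionals need not be subadditive. Along a chain it is,
  because two members can be replaced by the smaller one before subadditivity is applied.
\<close>

lemma sublinear_INF_chain:
  assumes sub: "\<And>p. p \<in> C \<Longrightarrow> sublinear p"
    and ne: "C \<noteq> {}"
    and chain: "\<And>p q. p \<in> C \<Longrightarrow> q \<in> C \<Longrightarrow> p \<le> q \<or> q \<le> p"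
    and bdd: "\<And>x. bdd_below ((\<lambda>p. p x) ` C)"
  shows "sublinear (\<lambda>x. INF p\<in>C. p x)"
  unfolding sublinear_def
proof (intro conjI allI impI)
  let ?u = "\<lambda>x. INF p\<in>C. p x"
  have low: "?u x \<le> p x" if "p \<in> C" for p x
    using bdd that by (rule cINF_lower)
  fix x y
  have *: "?u (x + y) \<le> p x + q y" if pq: "p \<in> C" "q \<in> C" for p q
  proof -
    obtain r where r: "r \<in> C" "r \<le> p" "r \<le> q" using chain[OF pq] pq by auto
    have "?u (x + y) \<le> r (x + y)" using r(1) by (rule low)
    also have "\<dots> \<le> r x + r y" using sub[OF r(1)] by (rule sublinear_add)
    also have "\<dots> \<le> p x + q y" using r(2,3) by (intro add_mono) (auto simp: le_fun_def)
    finally show ?thesis .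
  qed
  have "?u (x + y) - p x \<le> ?u y" if "p \<in> C" for p
    using ne by (rule cINF_greatest) (use *[OF that] in \<open>simp add: algebra_simps\<close>)
  then have "?u (x + y) - ?u y \<le> ?u x"
    by (intro cINF_greatest[OF ne]) (simp add: algebra_simps)
  then show "?u (x + y) \<le> ?u x + ?u y" by simp
  fix c :: real assume c: "0 < c"
  have "?u (c *\<^sub>R x) / c \<le> ?u x"
  proof (rule cINF_greatest[OF ne])
    fix p assume p: "p \<in> C"
    have "?u (c *\<^sub>R x) \<le> c * p x"
      using low[OF p, of "c *\<^sub>R x"] sublinear_scaleR[OF sub[OF p]] c by simp
    then show "?u (c *\<^sub>R x) / c \<le> p x" using c by (simp add: field_simps)
  qed
  then show "?u (c *\<^sub>R x) \<le> c * ?u x" using c by (simp add: field_simps)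
qed

text \<open>
  The largest sublinear functional below \<open>p\<close> that is at most \<open>- p a\<close> at \<open>- a\<close>, which makes it
  linear on the line through \<open>a\<close>.
\<close>

definition tilt :: "('v::real_vector \<Rightarrow> real) \<Rightarrow> 'v \<Rightarrow> 'v \<Rightarrow> real" where
  "tilt p a x = (INF t\<in>{0..}. p (x + t *\<^sub>R a) - t * p a)"

lemma tilt_le:
  assumes "sublinear p" "0 \<le> t"
  shows "tilt p a x \<le> p (x + t *\<^sub>R a) - t * p a"
  unfolding tilt_def
proof (rule cINF_lower)
  \<comment> \<open>The infimum is over a set bounded below, so it is a genuine lower bound.\<close>
  have "- p (- x) \<le> p (x + t *\<^sub>R a) - t * p a" if "0 \<le> t" for t
    using sublinear_add[OF assms(1), of "x + t *\<^sub>R a" "- x"]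
      sublinear_scaleR[OF assms(1) that, of a] by simp
  then show "bdd_below ((\<lambda>t. p (x + t *\<^sub>R a) - t * p a) ` {0..})"
    by (intro bdd_belowI2[where m = "- p (- x)"]) auto
qed (use assms(2) in auto)

lemma sublinear_tilt:
  assumes p: "sublinear p"
  shows "sublinear (tilt p a)"
  unfolding sublinear_def
proof (intro conjI allI impI)
  fix x y
  have *: "tilt p a (x + y) \<le> (p (x + s *\<^sub>R a) - s * p a) + (p (y + t *\<^sub>R a) - t * p a)"
    if "0 \<le> s" "0 \<le> t" for s t
  proof -
    have "tilt p a (x + y) \<le> p ((x + y) + (s + t) *\<^sub>R a) - (s + t) * p a"
      using that by (intro tilt_le[OF p]) simp
    also have "(x + y) + (s + t) *\<^sub>R a = (x + s *\<^sub>R a) + (y + t *\<^sub>R a)"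
      by (simp add: algebra_simps)
    finally show ?thesis
      using sublinear_add[OF p, of "x + s *\<^sub>R a" "y + t *\<^sub>R a"] by (simp add: algebra_simps)
  qed
  have "tilt p a (x + y) - (p (x + s *\<^sub>R a) - s * p a) \<le> tilt p a y" if "0 \<le> s" for s
    unfolding tilt_def[of p a y]
    by (rule cINF_greatest) (use *[OF that] in \<open>auto simp: algebra_simps\<close>)
  then have "tilt p a (x + y) - tilt p a y \<le> p (x + s *\<^sub>R a) - s * p a" if "0 \<le> s" for s
    using that by (force simp: algebra_simps)
  then have "tilt p a (x + y) - tilt p a y \<le> tilt p a x"
    unfolding tilt_def[of p a x] by (intro cINF_greatest) auto
  then show "tilt p a (x + y) \<le> tilt p a x + tilt p a y" by simp
  fix c :: real assume c: "0 < c"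
  have "tilt p a (c *\<^sub>R x) / c \<le> p (x + t *\<^sub>R a) - t * p a" if "0 \<le> t" for t
  proof -
    have "tilt p a (c *\<^sub>R x) \<le> p (c *\<^sub>R x + (c * t) *\<^sub>R a) - (c * t) * p a"
      using that c by (intro tilt_le[OF p]) simp
    also have "c *\<^sub>R x + (c * t) *\<^sub>R a = c *\<^sub>R (x + t *\<^sub>R a)"
      by (simp add: algebra_simps)
    also have "p (c *\<^sub>R (x + t *\<^sub>R a)) = c * p (x + t *\<^sub>R a)"
      using p c by (simp add: sublinear_scaleR)
    finally show ?thesis using c by (simp add: field_simps)
  qed
  then have "tilt p a (c *\<^sub>R x) / c \<le> tilt p a x"
    unfolding tilt_def[of p a x] by (intro cINF_greatest) auto
  then show "tilt p a (c *\<^sub>R x) \<le> c * tilt p a x" using c by (simp add: field_simps)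
qed

lemma tilt_below: "sublinear p \<Longrightarrow> tilt p a \<le> p"
  using tilt_le[of p 0 a] by (auto simp: le_fun_def)

text \<open>
  Tilting cannot lower a minimal functional, so \<open>p \<le> tilt p a\<close>. The member \<open>t = 1\<close> of the infimum
  then reads \<open>p x + p a \<le> p (x + a)\<close>, the missing half of additivity.
\<close>

lemma minimal_sublinear_linear:
  assumes p: "sublinear p" and min: "\<And>q. sublinear q \<Longrightarrow> q \<le> p \<Longrightarrow> q = p"
  shows "linear p"
proof -
  have "p x + p a \<le> p (x + a)" for x a
    using tilt_le[OF p, of 1 a x] min[OF sublinear_tilt[OF p] tilt_below[OF p], of a] by simp
  then have add: "p (x + y) = p x + p y" for x y
    using sublinear_add[OF p, of x y] by (metis antisym)
  have minus: "p (- x) = - p x" for x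
    using add[of x "- x"] sublinear_zero[OF p] by simp
  have "p (c *\<^sub>R x) = c * p x" for c x
    using sublinear_scaleR[OF p, of c x] sublinear_scaleR[OF p, of "- c" x] minus[of "c *\<^sub>R x"]
    by (cases "0 \<le> c") auto
  with add show ?thesis by (intro linearI) auto
qed

text \<open>
  A Hahn--Banach theorem without extension of partial functionals: Zorn's lemma, applied to the
  sublinear functionals below \<open>p0\<close>, gives a minimal one, which is linear.
\<close>

lemma linear_below_sublinear:
  assumes p0: "sublinear p0"
  obtains f where "linear f" "f \<le> p0"
proof -
  let ?A = "{p. sublinear p \<and> p \<le> p0}"
  let ?below = "\<lambda>p q. q \<le> p"
  have "\<exists>m\<in>?A. \<forall>q\<in>?A. q \<le> m \<longrightarrow> q = m"
  proof (rule predicate_Zorn)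
    show "partial_order_on ?A (relation_of ?below ?A)"
      by (rule partial_order_on_relation_ofI) auto
    fix C assume "C \<in> Chains (relation_of ?below ?A)"
    then have sub: "\<And>p. p \<in> C \<Longrightarrow> sublinear p" and le: "\<And>p. p \<in> C \<Longrightarrow> p \<le> p0"
      and chain: "\<And>p q. p \<in> C \<Longrightarrow> q \<in> C \<Longrightarrow> p \<le> q \<or> q \<le> p"
      unfolding Chains_def relation_of_def by blast+
    show "\<exists>u\<in>?A. \<forall>a\<in>C. u \<le> a"
    proof (cases "C = {}")
      case True
      then show ?thesis using p0 by auto
    next
      case ne: False
      let ?u = "\<lambda>x. INF p\<in>C. p x"
      have bdd: "bdd_below ((\<lambda>p. p x) ` C)" for x
      proof (rule bdd_belowI2)
        fix p assume "p \<in> C"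
        \<comment> \<open>Pointwise infima of reals are meaningful because every member dominates this value.\<close>
        then show "- p0 (- x) \<le> p x"
          using sublinear_minus_le[OF sub, of p x] le[of p] by (auto simp: le_fun_def intro: order_trans[rotated])
      qed
      have low: "?u \<le> p" if "p \<in> C" for p
        unfolding le_fun_def using cINF_lower[OF bdd that] by blast
      obtain p where "p \<in> C" using ne by auto
      then have "?u \<le> p0" using low le order_trans by blast
      with sublinear_INF_chain[OF sub ne chain bdd] low show ?thesis
        by (intro bexI[of _ ?u]) auto
    qed
  qed
  then obtain m where m: "sublinear m" "m \<le> p0"
    and min: "\<And>q. sublinear q \<Longrightarrow> q \<le> p0 \<Longrightarrow> q \<le> m \<Longrightarrow> q = m" by blast
  then have "linear m"
    by (intro minimal_sublinear_linear) (auto intro: order_trans)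
  with m(2) that show thesis by blast
qed

text \<open>
  A linear functional below the norm is automatically bounded by one. Starting from the norm
  tilted along \<open>v\<close> forces in addition the value at \<open>- v\<close> down to \<open>- norm v\<close>.
\<close>

lemma norming_functional:
  fixes v :: "'v::real_normed_vector"
  obtains f :: "'v \<Rightarrow>\<^sub>L real" where "norm f \<le> 1" "f v = norm v"
proof -
  have n: "sublinear (norm :: 'v \<Rightarrow> real)"
    by (simp add: sublinear_def norm_triangle_ineq)
  obtain f where f: "linear f" "f \<le> tilt norm v"
    using linear_below_sublinear[OF sublinear_tilt[OF n]] .
  have le: "f x \<le> norm x" for x
    using f(2) tilt_below[OF n, of v] by (auto simp: le_fun_def intro: order_trans)
  have abs: "norm (f x) \<le> norm x * 1" for x
    using le[of x] le[of "- x"] linear_neg[OF f(1), of x] by simp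
  then have bl: "bounded_linear f"
    using f(1) by (intro bounded_linear_intro[where K = 1])
      (auto simp: linear_add linear_scale)
  have "f (- v) \<le> - norm v"
    using f(2) tilt_le[OF n, of 1 v "- v"] by (auto simp: le_fun_def intro: order_trans)
  then have "f v = norm v"
    using le[of v] linear_neg[OF f(1), of v] by simp
  moreover have "norm (Blinfun f) \<le> 1"
    using abs by (intro norm_blinfun_bound) (simp_all add: bounded_linear_Blinfun_apply[OF bl])
  ultimately show thesis
    using that[of "Blinfun f"] by (simp add: bounded_linear_Blinfun_apply[OF bl])
qed

text \<open>
  Test \<open>A x\<close> against the functional that norms it.
\<close>

lemma norm_le_of_dual_adjoint:
  fixes A :: "'v::real_normed_vector \<Rightarrow>\<^sub>L 'v"
  assumes "\<And>f. norm f \<le> 1 \<Longrightarrow> norm (dual_adjoint A f) \<le> c"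
  shows "norm A \<le> c"
proof (rule norm_blinfun_bound)
  show "0 \<le> c" by (rule order_trans[OF norm_ge_zero assms[of 0]]) simp
  fix x
  obtain f where f: "norm f \<le> 1" "blinfun_apply f (A x) = norm (A x)"
    using norming_functional .
  have "norm (A x) = dual_adjoint A f x"
    using f(2) by (simp add: dual_adjoint_def)
  also have "\<dots> \<le> norm (dual_adjoint A f) * norm x"
    using norm_blinfun[of "dual_adjoint A f" x] by simp
  also have "\<dots> \<le> c * norm x" using assms[OF f(1)] by (rule mult_right_mono) simp
  finally show "norm (A x) \<le> c * norm x" .
qed

lemma norm_dual_adjoint_le: "norm (dual_adjoint A f) \<le> norm f * norm A"
  unfolding dual_adjoint_def by (rule norm_blinfun_compose)

lemma norm_dual_adjoint_compose_le:
  "norm (dual_adjoint (A o\<^sub>L B) f) \<le> norm (dual_adjoint A f) * norm B"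
proof -
  have "dual_adjoint (A o\<^sub>L B) f = dual_adjoint A f o\<^sub>L B"
    by (rule blinfun_eqI) (simp add: dual_adjoint_def)
  then show ?thesis by (simp add: norm_blinfun_compose)
qed

section \<open>Growth bounds as operator norm bounds\<close>

lemma skew_compose:
  assumes "skew_evolution_semiflow \<phi> \<Phi>" "0 \<le> t0" "t0 \<le> s" "s \<le> t"
  shows "\<Phi> t s (\<phi> s t0 x) o\<^sub>L \<Phi> s t0 x = \<Phi> t t0 x"
  using assms by (simp add: skew_evolution_semiflow_def evolution_cocycle_def time_pairs_def)

text \<open>
  All growth and stability notions compare \<open>\<Phi> t t0 x v\<close> with \<open>\<Phi> s t0 x v\<close>. By the cocycle
  identity this is a bound on the operator that leads from time \<open>s\<close> to time \<open>t\<close>; conversely, the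
  choice \<open>s = t0\<close> recovers the operator bound.
\<close>

lemma cocycle_bound_iff:
  fixes b :: "real \<Rightarrow> real"
  assumes C: "skew_evolution_semiflow \<phi> \<Phi>" and b: "\<And>r. 0 \<le> r \<Longrightarrow> 0 \<le> b r"
  shows "(\<forall>t s t0 x v. (t, s) \<in> time_pairs \<longrightarrow> (s, t0) \<in> time_pairs \<longrightarrow>
            norm (\<Phi> t t0 x v) \<le> b (t - s) * norm (\<Phi> s t0 x v))
     \<longleftrightarrow> (\<forall>t t0 x. (t, t0) \<in> time_pairs \<longrightarrow> norm (\<Phi> t t0 x) \<le> b (t - t0))"
    (is "?L \<longleftrightarrow> ?R")
proof
  assume L: ?L
  show ?R
  proof (intro allI impI norm_blinfun_bound)
    fix t t0 x v assume t: "(t, t0) \<in> time_pairs"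
    then have "(t0, t0) \<in> time_pairs" "\<Phi> t0 t0 x = id_blinfun"
      using C by (auto simp: time_pairs_def skew_evolution_semiflow_def evolution_cocycle_def)
    then show "norm (\<Phi> t t0 x v) \<le> b (t - t0) * norm v"
      using L t by (metis id_blinfun.rep_eq)
  qed (auto simp: time_pairs_def intro!: b)
next
  assume R: ?R
  show ?L
  proof (intro allI impI)
    fix t s t0 x v assume ts: "(t, s) \<in> time_pairs" and st: "(s, t0) \<in> time_pairs"
    have "\<Phi> t t0 x v = \<Phi> t s (\<phi> s t0 x) (\<Phi> s t0 x v)"
      using skew_compose[OF C, of t0 s t x] ts st by (auto simp: time_pairs_def simp flip: blinfun_apply_blinfun_compose)
    also have "norm \<dots> \<le> norm (\<Phi> t s (\<phi> s t0 x)) * norm (\<Phi> s t0 x v)"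
      by (rule norm_blinfun)
    also have "\<dots> \<le> b (t - s) * norm (\<Phi> s t0 x v)"
      using R ts by (intro mult_right_mono) auto
    finally show "norm (\<Phi> t t0 x v) \<le> b (t - s) * norm (\<Phi> s t0 x v)" .
  qed
qed

lemma uniform_exponential_growth_iff:
  assumes "skew_evolution_semiflow \<phi> \<Phi>"
  shows "uniform_exponential_growth \<Phi> \<longleftrightarrow>
    (\<exists>M\<ge>1. \<exists>\<omega>>0. \<forall>t t0 x. (t, t0) \<in> time_pairs \<longrightarrow> norm (\<Phi> t t0 x) \<le> M * exp (\<omega> * (t - t0)))"
proof -
  have eq: "(\<forall>t s t0 x v. (t, s) \<in> time_pairs \<longrightarrow> (s, t0) \<in> time_pairs \<longrightarrow>
            norm (\<Phi> t t0 x v) \<le> M * exp (\<omega> * (t - s)) * norm (\<Phi> s t0 x v))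
     \<longleftrightarrow> (\<forall>t t0 x. (t, t0) \<in> time_pairs \<longrightarrow> norm (\<Phi> t t0 x) \<le> M * exp (\<omega> * (t - t0)))"
    if "M \<ge> 1" for M \<omega> :: real
    by (rule cocycle_bound_iff[OF assms, of "\<lambda>r. M * exp (\<omega> * r)"]) (use that in simp)
  show ?thesis
    unfolding uniform_exponential_growth_def by (intro ex_cong1 conj_cong[OF refl] eq)
qed

lemma uniformly_exponentially_stable_iff:
  assumes "skew_evolution_semiflow \<phi> \<Phi>"
  shows "uniformly_exponentially_stable \<Phi> \<longleftrightarrow>
    (\<exists>N\<ge>1. \<exists>\<nu>>0. \<forall>t t0 x. (t, t0) \<in> time_pairs \<longrightarrow> norm (\<Phi> t t0 x) \<le> N * exp (- \<nu> * (t - t0)))"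
proof -
  have eq: "(\<forall>t s t0 x v. (t, s) \<in> time_pairs \<longrightarrow> (s, t0) \<in> time_pairs \<longrightarrow>
            norm (\<Phi> t t0 x v) \<le> N * exp (- \<nu> * (t - s)) * norm (\<Phi> s t0 x v))
     \<longleftrightarrow> (\<forall>t t0 x. (t, t0) \<in> time_pairs \<longrightarrow> norm (\<Phi> t t0 x) \<le> N * exp (- \<nu> * (t - t0)))"
    if "N \<ge> 1" for N \<nu> :: real
    by (rule cocycle_bound_iff[OF assms, of "\<lambda>r. N * exp (- \<nu> * r)"]) (use that in simp)
  show ?thesis
    unfolding uniformly_exponentially_stable_def by (intro ex_cong1 conj_cong[OF refl] eq)
qed

lemma exponentially_stable_imp_stable:
  assumes "uniformly_exponentially_stable \<Phi>"
  shows "uniformly_stable \<Phi>"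
proof -
  obtain N \<nu> where N: "N \<ge> 1" "\<nu> > 0" and bd: "\<And>t s t0 x v. (t, s) \<in> time_pairs \<Longrightarrow>
      (s, t0) \<in> time_pairs \<Longrightarrow> norm (\<Phi> t t0 x v) \<le> N * exp (- \<nu> * (t - s)) * norm (\<Phi> s t0 x v)"
    using assms unfolding uniformly_exponentially_stable_def by blast
  have "norm (\<Phi> t t0 x v) \<le> N * norm (\<Phi> s t0 x v)"
    if "(t, s) \<in> time_pairs" "(s, t0) \<in> time_pairs" for t s t0 x v
  proof -
    have "exp (- \<nu> * (t - s)) \<le> 1" using N that by (simp add: time_pairs_def)
    then have "N * exp (- \<nu> * (t - s)) * norm (\<Phi> s t0 x v) \<le> N * 1 * norm (\<Phi> s t0 x v)"
      using N by (intro mult_right_mono mult_left_mono) auto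
    with bd[OF that, of x v] show ?thesis by simp
  qed
  with N show ?thesis unfolding uniformly_stable_def by blast
qed

lemma stable_imp_exponential_growth:
  assumes "uniformly_stable \<Phi>"
  shows "uniform_exponential_growth \<Phi>"
proof -
  obtain N where N: "N \<ge> 1" and bd: "\<And>t s t0 x v. (t, s) \<in> time_pairs \<Longrightarrow>
      (s, t0) \<in> time_pairs \<Longrightarrow> norm (\<Phi> t t0 x v) \<le> N * norm (\<Phi> s t0 x v)"
    using assms unfolding uniformly_stable_def by blast
  have "norm (\<Phi> t t0 x v) \<le> N * exp (1 * (t - s)) * norm (\<Phi> s t0 x v)"
    if "(t, s) \<in> time_pairs" "(s, t0) \<in> time_pairs" for t s t0 x v
  proof -
    have "1 \<le> exp (1 * (t - s))" using that by (simp add: time_pairs_def)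
    then have "N * 1 * norm (\<Phi> s t0 x v) \<le> N * exp (1 * (t - s)) * norm (\<Phi> s t0 x v)"
      using N by (intro mult_right_mono mult_left_mono) auto
    with bd[OF that, of x v] show ?thesis by simp
  qed
  with N show ?thesis unfolding uniform_exponential_growth_def by (meson zero_less_one)
qed

section \<open>From exponential stability to the integral bound\<close>

text \<open>
  The bound does not depend on the length of the interval; an antiderivative of the integrand in \<open>s\<close>
  is \<open>N / \<nu> * exp (- \<nu> * (t - s))\<close>.
\<close>

lemma nn_integral_exp_decay_le:
  fixes \<nu> :: real
  assumes "\<nu> > 0" "N \<ge> 0"
  shows "(\<integral>\<^sup>+ s\<in>{t0..t}. ennreal (N * exp (- \<nu> * (t - s))) \<partial>lborel) \<le> ennreal (N / \<nu>)"
proof (cases "t0 \<le> t")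
  case True
  have "(\<integral>\<^sup>+ s\<in>{t0..t}. ennreal (N * exp (- \<nu> * (t - s))) \<partial>lborel)
      = ennreal (N / \<nu> * exp (- \<nu> * (t - t)) - N / \<nu> * exp (- \<nu> * (t - t0)))"
    using assms True
    by (intro nn_integral_FTC_Icc) (auto intro!: derivative_eq_intros simp flip: has_real_derivative_iff_has_vector_derivative)
  also have "\<dots> \<le> ennreal (N / \<nu>)"
    using assms by (intro ennreal_leI) simp
  finally show ?thesis .
qed simp

lemma exponentially_stable_imp_integral_bound:
  assumes C: "skew_evolution_semiflow \<phi> \<Phi>" and stable: "uniformly_exponentially_stable \<Phi>"
  shows "\<exists>R\<in>rate_functions. \<exists>N\<ge>1. adjoint_integral_bound \<phi> \<Phi> R N"
proof -
  obtain N \<nu> where N: "N \<ge> 1" "\<nu> > 0"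
    and bd: "\<And>t t0 x. (t, t0) \<in> time_pairs \<Longrightarrow> norm (\<Phi> t t0 x) \<le> N * exp (- \<nu> * (t - t0))"
    using stable uniformly_exponentially_stable_iff[OF C] by blast
  have "adjoint_integral_bound \<phi> \<Phi> (\<lambda>r. r) (max 1 (N / \<nu>))"
    unfolding adjoint_integral_bound_def
  proof (intro allI impI)
    fix t t0 x and f :: "'b \<Rightarrow>\<^sub>L real"
    assume t: "(t, t0) \<in> time_pairs" and f: "norm f \<le> 1"
    have "norm (dual_adjoint (\<Phi> t s (\<phi> s t0 x)) f) \<le> N * exp (- \<nu> * (t - s))"
      if "s \<in> {t0..t}" for s
    proof -
      have "norm (dual_adjoint (\<Phi> t s (\<phi> s t0 x)) f) \<le> 1 * norm (\<Phi> t s (\<phi> s t0 x))"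
        using norm_dual_adjoint_le mult_right_mono[OF f norm_ge_zero] by (rule order_trans)
      also have "\<dots> \<le> N * exp (- \<nu> * (t - s))"
        using bd[of t s] t that by (simp add: time_pairs_def)
      finally show ?thesis .
    qed
    then have "(\<integral>\<^sup>+ s\<in>{t0..t}. ennreal (norm (dual_adjoint (\<Phi> t s (\<phi> s t0 x)) f)) \<partial>lebesgue)
        \<le> (\<integral>\<^sup>+ s\<in>{t0..t}. ennreal (N * exp (- \<nu> * (t - s))) \<partial>lebesgue)"
      by (intro nn_integral_mono) (auto simp: indicator_def intro!: ennreal_leI)
    also have "\<dots> \<le> ennreal (N / \<nu>)"
      using nn_integral_exp_decay_le[of \<nu> N] N by (simp add: nn_integral_completion)
    also have "\<dots> \<le> ennreal (max 1 (N / \<nu>))" by (intro ennreal_leI) simp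
    finally show "(\<integral>\<^sup>+ s\<in>{t0..t}. ennreal (norm (dual_adjoint (\<Phi> t s (\<phi> s t0 x)) f)) \<partial>lebesgue)
        \<le> ennreal (max 1 (N / \<nu>))" .
  qed
  moreover have "(\<lambda>r. r) \<in> rate_functions"
    by (simp add: rate_functions_def mono_on_def)
  ultimately show ?thesis by (meson max.cobounded1)
qed

section \<open>From the integral bound to exponential stability\<close>

text \<open>
  If \<open>\<Phi> t t0 x\<close> were large, then the adjoints of \<open>\<Phi> t s (\<phi> s t0 x)\<close> would stay large for all \<open>s\<close> in
  the window after \<open>t0\<close> during which the orbit grows by a factor of at most \<open>B\<close>. A window of length
  more than \<open>N / R \<epsilon>\<close> then contradicts the integral bound.
\<close>

lemma late_norm_bound:
  assumes C: "skew_evolution_semiflow \<phi> \<Phi>"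
    and int: "adjoint_integral_bound \<phi> \<Phi> R N" and R: "R \<in> rate_functions"
    and N: "0 \<le> N" and t0: "0 \<le> t0" and \<tau>: "0 \<le> \<tau>" "t0 + \<tau> \<le> t"
    and B: "0 < B" "\<And>s. s \<in> {t0..t0 + \<tau>} \<Longrightarrow> norm (\<Phi> s t0 x) \<le> B"
    and \<epsilon>: "0 < \<epsilon>" "N < \<tau> * R \<epsilon>"
  shows "norm (\<Phi> t t0 x) \<le> B * \<epsilon>"
proof (rule norm_le_of_dual_adjoint, rule ccontr)
  fix f :: "'b \<Rightarrow>\<^sub>L real"
  let ?g = "\<lambda>s. norm (dual_adjoint (\<Phi> t s (\<phi> s t0 x)) f)"
  assume f: "norm f \<le> 1" and "\<not> norm (dual_adjoint (\<Phi> t t0 x) f) \<le> B * \<epsilon>"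
  then have big: "B * \<epsilon> < norm (dual_adjoint (\<Phi> t t0 x) f)" by simp
  have R\<epsilon>: "0 < R \<epsilon>" using R \<epsilon> by (simp add: rate_functions_def)
  have "R \<epsilon> \<le> R (?g s)" if s: "s \<in> {t0..t0 + \<tau>}" for s
  proof -
    have "norm (dual_adjoint (\<Phi> t t0 x) f) \<le> ?g s * norm (\<Phi> s t0 x)"
      using norm_dual_adjoint_compose_le[of "\<Phi> t s (\<phi> s t0 x)" "\<Phi> s t0 x" f]
        skew_compose[OF C t0, of s t x] s \<tau> by simp
    also have "\<dots> \<le> ?g s * B" using B(2)[OF s] by (rule mult_left_mono) simp
    finally have "B * \<epsilon> < B * ?g s" using big by (simp add: mult.commute)
    then have "\<epsilon> \<le> ?g s" using B(1) by simp
    then show ?thesis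
      using R \<epsilon> by (auto simp: rate_functions_def intro: mono_onD)
  qed
  then have "(\<integral>\<^sup>+ s\<in>{t0..t0 + \<tau>}. ennreal (R \<epsilon>) \<partial>lebesgue)
      \<le> (\<integral>\<^sup>+ s\<in>{t0..t}. ennreal (R (?g s)) \<partial>lebesgue)"
    using \<tau> by (intro nn_integral_mono) (auto simp: indicator_def intro!: ennreal_leI)
  also have "\<dots> \<le> ennreal N"
    using int f t0 \<tau> by (auto simp: adjoint_integral_bound_def time_pairs_def)
  finally have "ennreal (\<tau> * R \<epsilon>) \<le> ennreal N"
    using \<tau> R\<epsilon> by (simp add: nn_integral_cmult_indicator ennreal_mult mult.commute)
  then show False using \<epsilon> N by simp
qed

text \<open>
  Each full period \<open>L\<close> contributes a factor \<open>1 / 2\<close>, which gives the decay rate \<open>ln 2 / L\<close>. The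
  incomplete period costs the bound \<open>K\<close> and, when the number of periods is rounded down, a further
  factor \<open>2\<close>.
\<close>

lemma eventual_contraction_imp_exponentially_stable:
  assumes C: "skew_evolution_semiflow \<phi> \<Phi>" and K: "1 \<le> K" and L: "0 < L"
    and bdd: "\<And>t t0 x. (t, t0) \<in> time_pairs \<Longrightarrow> norm (\<Phi> t t0 x) \<le> K"
    and half: "\<And>t t0 x. 0 \<le> t0 \<Longrightarrow> t0 + L \<le> t \<Longrightarrow> norm (\<Phi> t t0 x) \<le> 1 / 2"
  shows "uniformly_exponentially_stable \<Phi>"
proof -
  have pow: "norm (\<Phi> t t0 x) \<le> K * (1 / 2) ^ n" if "0 \<le> t0" "t0 + real n * L \<le> t" for n t t0 x
    using that
  proof (induction n arbitrary: t)
    case 0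
    then show ?case using bdd by (simp add: time_pairs_def)
  next
    case (Suc n)
    let ?s = "t - L"
    have s: "t0 + real n * L \<le> ?s" using Suc.prems by (simp add: algebra_simps)
    moreover have "0 \<le> real n * L" using L by simp
    ultimately have st: "t0 \<le> ?s" "?s \<le> t" using L by linarith+
    have "norm (\<Phi> t t0 x) \<le> norm (\<Phi> t ?s (\<phi> ?s t0 x)) * norm (\<Phi> ?s t0 x)"
      using skew_compose[OF C \<open>0 \<le> t0\<close> st] by (metis norm_blinfun_compose)
    also have "\<dots> \<le> 1 / 2 * (K * (1 / 2) ^ n)"
      using half[of ?s t] Suc.IH[OF \<open>0 \<le> t0\<close> s] st Suc.prems K by (intro mult_mono) auto
    finally show ?case by simp
  qed
  define \<nu> where "\<nu> = ln 2 / L"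
  have \<nu>: "\<nu> > 0" using L by (simp add: \<nu>_def)
  have "norm (\<Phi> t t0 x) \<le> (2 * K) * exp (- \<nu> * (t - t0))" if "(t, t0) \<in> time_pairs" for t t0 x
  proof -
    define n where "n = nat \<lfloor>(t - t0) / L\<rfloor>"
    have "0 \<le> (t - t0) / L" using that L by (simp add: time_pairs_def)
    then have n: "real n \<le> (t - t0) / L" "(t - t0) / L \<le> real n + 1"
      unfolding n_def by linarith+
    have "t0 + real n * L \<le> t" using n(1) L by (simp add: field_simps)
    then have "norm (\<Phi> t t0 x) \<le> K * (1 / 2) ^ n"
      using pow that by (simp add: time_pairs_def)
    also have "(1 / 2) ^ n = 2 * exp (- (ln 2 * (real n + 1)))"
    proof -
      have "exp (- (ln 2 * (real n + 1))) = exp (real (Suc n) * - ln 2)"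
        by (simp add: algebra_simps)
      also have "\<dots> = exp (- ln (2::real)) ^ Suc n"
        by (rule exp_of_nat_mult)
      also have "exp (- ln (2::real)) = 1 / 2"
        by (simp add: exp_minus)
      finally show ?thesis by simp
    qed
    also have "\<dots> \<le> 2 * exp (- \<nu> * (t - t0))"
      using n(2) mult_left_mono[OF n(2), of "ln 2"] by (simp add: \<nu>_def)
    finally show ?thesis using K by simp
  qed
  moreover have "2 * K \<ge> 1" using K by simp
  ultimately show ?thesis
    using \<nu> uniformly_exponentially_stable_iff[OF C] by blast
qed

lemma growth_and_integral_bound_imp_exponentially_stable:
  assumes C: "skew_evolution_semiflow \<phi> \<Phi>" and growth: "uniform_exponential_growth \<Phi>"
    and R: "R \<in> rate_functions" and N: "N \<ge> 1" and int: "adjoint_integral_bound \<phi> \<Phi> R N"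
  shows "uniformly_exponentially_stable \<Phi>"
proof -
  obtain M \<omega> where M: "M \<ge> 1" "\<omega> > 0"
    and bd: "\<And>t t0 x. (t, t0) \<in> time_pairs \<Longrightarrow> norm (\<Phi> t t0 x) \<le> M * exp (\<omega> * (t - t0))"
    using growth uniform_exponential_growth_iff[OF C] by blast
  \<comment> \<open>A window that exceeds \<open>N / R \<epsilon>\<close>, so that the integral of \<open>R \<epsilon>\<close> over it exceeds \<open>N\<close>.\<close>
  define L where "L \<epsilon> = N / R \<epsilon> + 1" for \<epsilon>
  have L: "0 < L \<epsilon>" "N < L \<epsilon> * R \<epsilon>" if "0 < \<epsilon>" for \<epsilon>
    using R that N by (auto simp: rate_functions_def L_def field_simps add_pos_pos)
  \<comment> \<open>The growth bound at the end of the window for \<open>\<epsilon> = 1\<close>; past it, the integral bound takes over.\<close>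
  define K where "K = M * exp (\<omega> * L 1)"
  have K: "1 \<le> K"
    using M L[of 1] mult_mono[of 1 M 1 "exp (\<omega> * L 1)"] by (simp add: K_def)
  have early: "norm (\<Phi> t t0 x) \<le> K" if "0 \<le> t0" "t0 \<le> t" "t \<le> t0 + L 1" for t t0 x
  proof -
    have "M * exp (\<omega> * (t - t0)) \<le> K"
      using that M by (simp add: K_def)
    with bd[of t t0 x] that show ?thesis by (simp add: time_pairs_def)
  qed
  have bdd: "norm (\<Phi> t t0 x) \<le> K" if "(t, t0) \<in> time_pairs" for t t0 x
  proof (cases "t \<le> t0 + L 1")
    case True
    with early that show ?thesis by (simp add: time_pairs_def)
  next
    case False
    with late_norm_bound[OF C int R _, of t0 "L 1" t K x 1] early L[of 1] K N that
    show ?thesis by (simp add: time_pairs_def)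
  qed
  \<comment> \<open>Chosen so that \<open>late_norm_bound\<close> with \<open>B = K\<close> yields \<open>K * \<epsilon> = 1 / 2\<close>.\<close>
  let ?\<epsilon> = "1 / (2 * K)"
  have "norm (\<Phi> t t0 x) \<le> 1 / 2" if "0 \<le> t0" "t0 + L ?\<epsilon> \<le> t" for t t0 x
    using late_norm_bound[OF C int R _, of t0 "L ?\<epsilon>" t K x ?\<epsilon>] bdd L[of ?\<epsilon>] K N that
    by (simp add: time_pairs_def)
  then show ?thesis
    using eventual_contraction_imp_exponentially_stable[OF C K _ bdd] L[of ?\<epsilon>] K by simp
qed

theorem theorem3p4:
  fixes \<phi> :: "real \<Rightarrow> real \<Rightarrow> 'x::metric_space \<Rightarrow> 'x"
    and \<Phi> :: "real \<Rightarrow> real \<Rightarrow> 'x \<Rightarrow> ('v::banach \<Rightarrow>\<^sub>L 'v)"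
  assumes "skew_evolution_semiflow \<phi> \<Phi>"
    and "star_strongly_measurable \<phi> \<Phi>"
  shows "(uniformly_exponentially_stable \<Phi> \<longleftrightarrow>
            uniformly_stable \<Phi> \<and>
            (\<exists>R\<in>rate_functions. \<exists>N\<ge>1. adjoint_integral_bound \<phi> \<Phi> R N))
       \<and> (uniformly_exponentially_stable \<Phi> \<longleftrightarrow>
            uniform_exponential_growth \<Phi> \<and>
            (\<exists>R\<in>rate_functions. \<exists>N\<ge>1. adjoint_integral_bound \<phi> \<Phi> R N))"
proof -
  let ?bound = "\<exists>R\<in>rate_functions. \<exists>N\<ge>1. adjoint_integral_bound \<phi> \<Phi> R N"
  have "uniformly_exponentially_stable \<Phi> \<Longrightarrow> ?bound"
    by (rule exponentially_stable_imp_integral_bound[OF assms(1)])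
  moreover have "uniformly_exponentially_stable \<Phi>"
    if growth: "uniform_exponential_growth \<Phi>" and bound: ?bound
  proof -
    obtain R N where "R \<in> rate_functions" "N \<ge> 1" "adjoint_integral_bound \<phi> \<Phi> R N"
      using bound by blast
    then show ?thesis
      by (rule growth_and_integral_bound_imp_exponentially_stable[OF assms(1) growth])
  qed
  ultimately show ?thesis
    using exponentially_stable_imp_stable[of \<Phi>] stable_imp_exponential_growth[of \<Phi>]
    by argo
qed

end
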